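(* There are absolute constants $C>0$ and $\alpha>0$ such that the following holds. Let $n,N,c$ be positive integers with $N\ge 10n$, let $f:\mathbb{F}_2^n\to[0,1]$, and let $F:(\mathbb{F}_2^n)^N\to[0,1]$ be defined by $F(x_1,\ldots,x_N)=f(x_1+\cdots+x_N)$. Suppose that $F$ is $\varepsilon$-approximated by a one-way broadcasting protocol with $c$ bits of communication per message. Then there is a linear sketch $\mathbf{g}:\mathbb{F}_2^n\to[0,1]$ of cost $k$ that $\varepsilon'$-approximates $f$, where $k\le Cc$ (i.e. $k=O(c)$) and $\varepsilon' = 2\varepsilon + 2^{-\alpha N}$.
   Context: One-way broadcasting protocol: there are $N$ players, player $i$ holding input $x_i\in\mathbb{F}_2^n$, and the players share a random string $\mathbf{r}\in\{0,1\}^{r}$. The players speak in order $1,\ldots,N$; player $i$ sends the message $\mathbf{m}_i = M_i(x_i,\mathbf{m}_1,\ldots,\mathbf{m}_{i-1},\mathbf{r})$, where for $1\le i\le N-1$ the message $\mathbf{m}_i\in\{0,1\}^c$, and the last message $\mathbf{m}_N\in[0,1]$ is the output of the protocol, written $G(x_1,\ldots,x_N,\mathbf{r})$. The protocol $\varepsilon$-approximates $F$ if for all inputs $x_1,\ldots,x_N\in\mathbb{F}_2^n$, $\mathbb{E}_{\mathbf{r}}\big[|G(x_1,\ldots,x_N,\mathbf{r})-F(x_1,\ldots,x_N)|^2\big]\le\varepsilon$. A function $g:\mathbb{F}_2^n\to[0,1]$ is a $k$-linear-junta if $g(x)=h(\ell_1(x),\ldots,\ell_k(x))$ for linear functions $\ell_1,\ldots,\ell_k:\mathbb{F}_2^n\to\mathbb{F}_2$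 and an arbitrary $h:\mathbb{F}_2^k\to[0,1]$. A linear sketch of cost $k$ is a probability distribution $\mathbf{g}$ over such $k$-linear-juntas; it $\varepsilon'$-approximates $f$ if for every $x\in\mathbb{F}_2^n$, $\mathbb{E}\big[|\mathbf{g}(x)-f(x)|^2\big]\le\varepsilon'$. *)

theory Defs
  imports
    "HOL-Library.Z2"
    "HOL-Probability.Probability_Mass_Function"
    "Jordan_Normal_Form.Matrix"
begin

text \<open>The field with two elements is the type \<^typ>\<open>bit\<close>, and its n-dimensional coordinate space is
  \<^term>\<open>carrier_vec n :: bit vec set\<close>. Strings over {0,1} that are used only as strings
  (messages, shared randomness) are boolean lists. A tuple of inputs is a function on {1..N}.\<close>

type_synonym bitstring = "bool list"

definition bitstrings :: "nat \<Rightarrow> bitstring set" where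
  "bitstrings m = {s. length s = m}"

text \<open>In \<open>msg P i x ms r\<close> and \<open>out P x ms r\<close>, the argument \<open>x\<close> is the speaking player's own
  input, \<open>ms\<close> is the list of all earlier messages in the order in which they were sent, and \<open>r\<close>
  is the shared random string. Players \<open>1, \<dots>, N - 1\<close> use \<open>msg\<close>; player \<open>N\<close> uses \<open>out\<close>.\<close>

record broadcast_protocol =
  rand_len :: nat
  msg :: "nat \<Rightarrow> bit vec \<Rightarrow> bitstring list \<Rightarrow> bitstring \<Rightarrow> bitstring"
  out :: "bit vec \<Rightarrow> bitstring list \<Rightarrow> bitstring \<Rightarrow> real"

definition one_way_broadcasting :: "nat \<Rightarrow> nat \<Rightarrow> nat \<Rightarrow> broadcast_protocol \<Rightarrow> bool" where
  "one_way_broadcasting n N c P \<longleftrightarrow>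
     (\<forall>i\<in>{1..<N}. \<forall>x\<in>carrier_vec n. \<forall>ms. \<forall>r\<in>bitstrings (rand_len P).
        length ms = i - 1 \<and> set ms \<subseteq> bitstrings c \<longrightarrow> msg P i x ms r \<in> bitstrings c) \<and>
     (\<forall>x\<in>carrier_vec n. \<forall>ms. \<forall>r\<in>bitstrings (rand_len P).
        length ms = N - 1 \<and> set ms \<subseteq> bitstrings c \<longrightarrow> out P x ms r \<in> {0..1})"

primrec transcript ::
  "broadcast_protocol \<Rightarrow> (nat \<Rightarrow> bit vec) \<Rightarrow> bitstring \<Rightarrow> nat \<Rightarrow> bitstring list" where
  "transcript P x r 0 = []"
| "transcript P x r (Suc i) =
     transcript P x r i @ [msg P (Suc i) (x (Suc i)) (transcript P x r i) r]"

definition protocol_output ::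
  "nat \<Rightarrow> broadcast_protocol \<Rightarrow> (nat \<Rightarrow> bit vec) \<Rightarrow> bitstring \<Rightarrow> real" where
  "protocol_output N P x r = out P (x N) (transcript P x r (N - 1)) r"

definition protocol_approximates ::
  "nat \<Rightarrow> nat \<Rightarrow> real \<Rightarrow> broadcast_protocol \<Rightarrow> ((nat \<Rightarrow> bit vec) \<Rightarrow> real) \<Rightarrow> bool" where
  "protocol_approximates n N \<epsilon> P F \<longleftrightarrow>
     (\<forall>x \<in> {1..N} \<rightarrow> carrier_vec n.
        measure_pmf.expectation (pmf_of_set (bitstrings (rand_len P)))
          (\<lambda>r. \<bar>protocol_output N P x r - F x\<bar>\<^sup>2) \<le> \<epsilon>)"

definition linear_functional :: "nat \<Rightarrow> (bit vec \<Rightarrow> bit) \<Rightarrow> bool" where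
  "linear_functional n L \<longleftrightarrow>
     (\<forall>x\<in>carrier_vec n. \<forall>y\<in>carrier_vec n. L (x + y) = L x + L y) \<and>
     (\<forall>a. \<forall>x\<in>carrier_vec n. L (a \<cdot>\<^sub>v x) = a * L x)"

text \<open>Functions on the n-dimensional space are represented by functions on all of
  \<^typ>\<open>bit vec\<close>; their values on vectors of other dimensions are irrelevant throughout.\<close>

definition linear_junta :: "nat \<Rightarrow> nat \<Rightarrow> (bit vec \<Rightarrow> real) \<Rightarrow> bool" where
  "linear_junta n k g \<longleftrightarrow>
     (\<exists>L h. (\<forall>i<k. linear_functional n (L i)) \<and> h \<in> carrier_vec k \<rightarrow> {0..1::real} \<and>
        (\<forall>x\<in>carrier_vec n. g x = h (vec k (\<lambda>i. L i x))))"

text \<open>Discrete distributions suffice for sketches: there are only finitely many tuples of linear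
  functionals, and replacing the outer functions belonging to one tuple by their conditional
  mean does not increase the mean squared error, by Jensen's inequality.\<close>

definition linear_sketch :: "nat \<Rightarrow> nat \<Rightarrow> (bit vec \<Rightarrow> real) pmf \<Rightarrow> bool" where
  "linear_sketch n k S \<longleftrightarrow> (\<forall>g\<in>set_pmf S. linear_junta n k g)"

definition sketch_approximates ::
  "nat \<Rightarrow> real \<Rightarrow> (bit vec \<Rightarrow> real) pmf \<Rightarrow> (bit vec \<Rightarrow> real) \<Rightarrow> bool" where
  "sketch_approximates n \<epsilon> S f \<longleftrightarrow>
     (\<forall>x\<in>carrier_vec n. measure_pmf.expectation S (\<lambda>g. \<bar>g x - f x\<bar>\<^sup>2) \<le> \<epsilon>)"

end

theory Submission
  imports Defs
begin

text \<open>Fix the shared randomness, let the first \<open>K = N - 1\<close> inputs be uniform and let the last player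
  hold \<open>x\<close> plus their sum, so that the total is \<open>x\<close>. Given the transcript, the first \<open>K\<close> inputs are
  uniform on a box \<open>\<Prod>i. A i\<close>, and the conditional mean of the output estimates \<open>f x\<close> at least as
  well as the protocol does. There are at most \<open>2 ^ (c * K)\<close> transcripts, so outside an event of
  probability \<open>2 ^ -(c * K)\<close> the box has density at least \<open>4 ^ -(c * K)\<close>. By Chang's level-1
  inequality, summed over the players, the characters whose squared biases on the \<open>A i\<close> are at least
  \<open>1/16\<close> on average are then spanned by \<open>128 * c\<close> of them. For every other character the product of
  the biases is at most \<open>4 ^ -K\<close>, which beats the \<open>2 ^ n\<close> terms of the Fourier expansion as
  \<open>N \<ge> 10 * n\<close>. Hence the conditional mean is almost a function of those \<open>128 * c\<close> characters.\<close>

section \<open>Characters of the binary space\<close>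

lemma bit_vec_plus_self:
  assumes "x \<in> carrier_vec n"
  shows "x + x = (0\<^sub>v n :: bit vec)"
proof (rule eq_vecI)
  fix i assume "i < dim_vec (0\<^sub>v n :: bit vec)"
  then show "(x + x) $ i = (0\<^sub>v n) $ i"
    using assms by (cases "x $ i") auto
qed (use assms in auto)

lemma bit_vec_add_cancel:
  assumes "x \<in> carrier_vec n" "y \<in> carrier_vec n"
  shows "y + (x + y) = (x :: bit vec)"
proof -
  have "y + (x + y) = x + (y + y)"
    using assms by (metis add_carrier_vec assoc_add_vec comm_add_vec)
  then show ?thesis
    using assms by (simp add: bit_vec_plus_self)
qed

lemma bit_vec_eq_add_iff:
  assumes "x \<in> carrier_vec n" "y \<in> carrier_vec n"
  shows "x + y = 0\<^sub>v n \<longleftrightarrow> x = (y :: bit vec)"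
  using assms bit_vec_add_cancel[of x n y] by (auto simp: bit_vec_plus_self)

lemma carrier_vec_bit_eq_image:
  "(carrier_vec n :: bit vec set) = vec_of_list ` {xs. set xs \<subseteq> {0, 1} \<and> length xs = n}"
proof (intro equalityI subsetI)
  fix x :: "bit vec" assume x: "x \<in> carrier_vec n"
  have "x = vec_of_list (list_of_vec x)" by (simp add: vec_list)
  moreover have "set (list_of_vec x) \<subseteq> {0, 1}"
    by (metis bit_not_zero_iff insertI1 insertI2 subsetI)
  ultimately show "x \<in> vec_of_list ` {xs. set xs \<subseteq> {0, 1} \<and> length xs = n}"
    using x by (intro image_eqI[of _ _ "list_of_vec x"]) auto
qed (auto intro: carrier_vecI)

lemma finite_carrier_vec_bit [simp]: "finite (carrier_vec n :: bit vec set)"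
  unfolding carrier_vec_bit_eq_image by (intro finite_imageI finite_lists_length_eq) simp

lemma card_carrier_vec_bit_le: "card (carrier_vec n :: bit vec set) \<le> 2 ^ n"
proof -
  have "card (carrier_vec n :: bit vec set) \<le> card {xs :: bit list. set xs \<subseteq> {0, 1} \<and> length xs = n}"
    unfolding carrier_vec_bit_eq_image by (intro card_image_le finite_lists_length_eq) simp
  also have "\<dots> = 2 ^ n"
    by (subst card_lists_length_eq) (auto simp: numeral_2_eq_2)
  finally show ?thesis .
qed

lemma card_carrier_vec_bit_pos: "0 < card (carrier_vec n :: bit vec set)"
  by (metis card_gt_0_iff empty_iff finite_carrier_vec_bit zero_carrier_vec)

text \<open>The character (-1)^(g . x); the scalar product is a bit, so the sign is chosen by
  cases.\<close>

definition chi :: "bit vec \<Rightarrow> bit vec \<Rightarrow> real" where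
  "chi g x = (if g \<bullet> x = 0 then 1 else -1)"

lemma chi_zero [simp]: "x \<in> carrier_vec n \<Longrightarrow> chi (0\<^sub>v n) x = 1"
  by (simp add: chi_def)

lemma chi_commute: "g \<in> carrier_vec n \<Longrightarrow> x \<in> carrier_vec n \<Longrightarrow> chi g x = chi x g"
  by (simp add: chi_def comm_scalar_prod[of g n x])

lemma chi_add:
  assumes "g \<in> carrier_vec n" "x \<in> carrier_vec n" "y \<in> carrier_vec n"
  shows "chi g (x + y) = chi g x * chi g y"
  unfolding chi_def scalar_prod_add_distrib[OF assms]
  by (cases "g \<bullet> x"; cases "g \<bullet> y") auto

lemma abs_chi [simp]: "\<bar>chi g x\<bar> = 1"
  by (simp add: chi_def)

lemma chi_finsum:
  assumes "finite T" "f \<in> T \<rightarrow> carrier_vec n" "g \<in> carrier_vec n"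
  shows "chi g (finsum_vec TYPE(bit) n f T) = (\<Prod>t\<in>T. chi g (f t))"
  using assms
proof (induction T)
  case empty
  then show ?case by (simp add: finsum_vec_empty chi_def)
next
  case (insert t T)
  then have "finsum_vec TYPE(bit) n f T \<in> carrier_vec n"
    by (intro finsum_vec_closed) auto
  with insert show ?case
    by (subst finsum_vec_insert) (auto simp: chi_add)
qed

lemma sum_chi:
  assumes "g \<in> carrier_vec n"
  shows "(\<Sum>x\<in>carrier_vec n. chi g x) = (if g = 0\<^sub>v n then real (card (carrier_vec n :: bit vec set)) else 0)"
proof (cases "g = 0\<^sub>v n")
  case False
  then obtain i where i: "i < n" "g $ i \<noteq> 0"
    using assms by (metis carrier_vecD eq_vecI index_zero_vec)
  \<comment> \<open>Translation by u permutes the space and flips the sign of \<open>chi g\<close>,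
    so the sum equals its own negative.\<close>
  define u :: "bit vec" where "u = unit_vec n i"
  have u: "u \<in> carrier_vec n" by (simp add: u_def)
  have "chi g u = -1"
    using i unfolding u_def chi_def by simp
  have "(\<Sum>x\<in>carrier_vec n. chi g x) = (\<Sum>x\<in>carrier_vec n. chi g (u + x))"
    by (rule sum.reindex_bij_witness[of _ "\<lambda>x. u + x" "\<lambda>x. u + x"])
      (use u in \<open>auto simp: bit_vec_add_cancel bit_vec_plus_self simp flip: assoc_add_vec\<close>)
  also have "\<dots> = - (\<Sum>x\<in>carrier_vec n. chi g x)"
    using assms u \<open>chi g u = -1\<close> by (simp add: chi_add sum_negf)
  finally show ?thesis using False by simp
qed simp

section \<open>Linear independence of characters\<close>

text \<open>Linear independence over the two-element field: coefficients are 0 or 1, so a nontrivial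
  combination is the sum over a nonempty subset.\<close>

definition independent_chars :: "nat \<Rightarrow> bit vec set \<Rightarrow> bool" where
  "independent_chars n J \<longleftrightarrow> (\<forall>T\<subseteq>J. T \<noteq> {} \<longrightarrow> finsum_vec TYPE(bit) n (\<lambda>g. g) T \<noteq> 0\<^sub>v n)"

lemma prod_chi_eq_chi_finsum:
  assumes "T \<subseteq> carrier_vec n" "x \<in> carrier_vec n"
  shows "(\<Prod>g\<in>T. chi g x) = chi (finsum_vec TYPE(bit) n (\<lambda>g. g) T) x"
proof -
  have "finite T" using assms finite_subset finite_carrier_vec_bit by blast
  then have "chi x (finsum_vec TYPE(bit) n (\<lambda>g. g) T) = (\<Prod>g\<in>T. chi x g)"
    using assms by (intro chi_finsum) auto
  moreover have "finsum_vec TYPE(bit) n (\<lambda>g. g) T \<in> carrier_vec n"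
    using assms by (intro finsum_vec_closed) auto
  moreover have "(\<Prod>g\<in>T. chi x g) = (\<Prod>g\<in>T. chi g x)"
    using assms by (intro prod.cong) (auto intro: chi_commute)
  ultimately show ?thesis using assms chi_commute by metis
qed

text \<open>A maximal independent subset works: any further g creates a relation. Spanning is stated
  as "values on J determine values on H", the form that juntas use.\<close>

lemma exists_spanning_independent_chars:
  assumes "H \<subseteq> carrier_vec n"
  shows "\<exists>J\<subseteq>H. independent_chars n J \<and>
    (\<forall>y\<in>carrier_vec n. \<forall>z\<in>carrier_vec n.
       (\<forall>g\<in>J. chi g y = chi g z) \<longrightarrow> (\<forall>g\<in>H. chi g y = chi g z))"
proof -
  have finH: "finite H" using assms finite_subset finite_carrier_vec_bit by blast
  have "finite {J. J \<subseteq> H \<and> independent_chars n J}"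
    using finH by (auto intro: finite_subset[of _ "Pow H"])
  moreover have "{} \<in> {J. J \<subseteq> H \<and> independent_chars n J}"
    by (simp add: independent_chars_def)
  ultimately have "\<exists>J\<in>{J. J \<subseteq> H \<and> independent_chars n J}.
      \<forall>K\<in>{J. J \<subseteq> H \<and> independent_chars n J}. J \<subseteq> K \<longrightarrow> J = K"
    by (intro finite_has_maximal) auto
  then obtain J where J: "J \<subseteq> H" "independent_chars n J"
    and max: "\<And>K. K \<subseteq> H \<Longrightarrow> independent_chars n K \<Longrightarrow> J \<subseteq> K \<Longrightarrow> J = K"
    by auto
  have "chi g y = chi g z"
    if yz: "y \<in> carrier_vec n" "z \<in> carrier_vec n" and eq: "\<forall>g\<in>J. chi g y = chi g z"
      and g: "g \<in> H" for y z g
  proof (cases "g \<in> J")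
    case False
    then have "\<not> independent_chars n (insert g J)"
      using max[of "insert g J"] g J by auto
    then obtain T where T: "T \<subseteq> insert g J" "T \<noteq> {}"
      "finsum_vec TYPE(bit) n (\<lambda>g. g) T = 0\<^sub>v n"
      by (auto simp: independent_chars_def)
    then have gT: "g \<in> T"
      using J(2) by (auto simp: independent_chars_def)
    have TV: "T \<subseteq> carrier_vec n" using T g J assms by auto
    have finT: "finite T" using TV finite_subset finite_carrier_vec_bit by blast
    \<comment> \<open>The relation T sums to zero, so its characters multiply to 1 everywhere, and
      \<open>chi g\<close> is determined by characters in J.\<close>
    have one: "chi g x * (\<Prod>h\<in>T - {g}. chi h x) = 1" if "x \<in> carrier_vec n" for x
      using prod_chi_eq_chi_finsum[OF TV that] that finT gT
      by (simp add: T(3) prod.remove)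
    have "(\<Prod>h\<in>T - {g}. chi h y) = (\<Prod>h\<in>T - {g}. chi h z)"
      using T eq by (intro prod.cong) auto
    then show ?thesis
      using one[OF yz(1)] one[OF yz(2)] by (metis mult_cancel_right mult_zero_right zero_neq_one)
  qed (use eq in auto)
  then show ?thesis using J by blast
qed

section \<open>Biases and the level-1 inequality\<close>

text \<open>The Fourier coefficient at g of the uniform distribution on A, with value 0 for empty
  A.\<close>

definition bias :: "bit vec set \<Rightarrow> bit vec \<Rightarrow> real" where
  "bias A g = (\<Sum>x\<in>A. chi g x) / real (card A)"

lemma abs_bias_le_1: "\<bar>bias A g\<bar> \<le> 1"
proof -
  have "\<bar>\<Sum>x\<in>A. chi g x\<bar> \<le> (\<Sum>x\<in>A. \<bar>chi g x\<bar>)" by (rule sum_abs)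
  also have "\<dots> = real (card A)" by simp
  finally show ?thesis
    unfolding bias_def by (cases "card A = 0") (auto simp: abs_divide field_simps)
qed

lemma exp_minus_le_quadratic:
  fixes a :: real
  assumes "0 \<le> a"
  shows "exp (- a) \<le> 1 - a + a\<^sup>2"
proof -
  \<comment> \<open>The right side is 1 + a^3, and its first factor is at most exp a.\<close>
  have "1 \<le> (1 + a) * (1 - a + a\<^sup>2)"
    using assms by (simp add: algebra_simps power2_eq_square)
  also have "\<dots> \<le> exp a * (1 - a + a\<^sup>2)"
  proof (intro mult_right_mono)
    have "0 \<le> (a - 1/2)\<^sup>2" by simp
    then show "0 \<le> 1 - a + a\<^sup>2" by (simp add: power2_eq_square algebra_simps)
  qed simp
  finally show ?thesis by (simp add: exp_minus field_simps)
qed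

text \<open>Averaging quadratic upper bounds for exp b and exp (-b) cancels the linear terms and
  leaves 1 + b^2.\<close>

lemma cosh_le_exp_square:
  fixes a :: real
  assumes "\<bar>a\<bar> \<le> 1"
  shows "cosh a \<le> exp (a\<^sup>2)"
proof -
  have "cosh b \<le> exp (b\<^sup>2)" if "0 \<le> b" "b \<le> 1" for b :: real
  proof -
    have "cosh b = (exp b + exp (- b)) / 2" by (simp add: cosh_field_def)
    also have "\<dots> \<le> 1 + b\<^sup>2"
      using exp_bound[of b] exp_minus_le_quadratic[of b] that by simp
    also have "\<dots> \<le> exp (b\<^sup>2)" by simp
    finally show ?thesis .
  qed
  from this[of "\<bar>a\<bar>"] show ?thesis using assms by (simp add: cosh_real_abs)
qed

text \<open>As \<open>chi\<close> takes only the values 1 and -1, the exponential is affine in it;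
  products of such exponentials become multilinear in the characters.\<close>

lemma exp_mult_chi: "exp (b * chi g x) = sinh b * chi g x + cosh b"
  by (simp add: chi_def sinh_field_def cosh_field_def field_simps)

text \<open>Expanding the product gives a sum over subsets T of J. By independence the character
  belonging to T sums to zero over the space unless T is empty.\<close>

lemma sum_exp_independent_chars:
  assumes J: "J \<subseteq> carrier_vec n" and ind: "independent_chars n J"
  shows "(\<Sum>x\<in>carrier_vec n. exp (\<Sum>g\<in>J. b g * chi g x))
    = real (card (carrier_vec n :: bit vec set)) * (\<Prod>g\<in>J. cosh (b g))"
proof -
  let ?V = "carrier_vec n :: bit vec set"
  have finJ: "finite J" using J finite_subset finite_carrier_vec_bit by blast
  have zero: "(\<Sum>x\<in>?V. \<Prod>g\<in>T. chi g x) = (if T = {} then real (card ?V) else 0)"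
    if "T \<subseteq> J" for T
  proof -
    have TV: "T \<subseteq> carrier_vec n" using that J by auto
    have "(\<Sum>x\<in>?V. \<Prod>g\<in>T. chi g x) = (\<Sum>x\<in>?V. chi (finsum_vec TYPE(bit) n (\<lambda>g. g) T) x)"
      by (intro sum.cong refl prod_chi_eq_chi_finsum TV)
    moreover have "finsum_vec TYPE(bit) n (\<lambda>g. g) T \<in> carrier_vec n"
      using TV by (intro finsum_vec_closed) auto
    ultimately show ?thesis
      using ind that by (auto simp: sum_chi independent_chars_def)
  qed
  have "(\<Sum>x\<in>?V. exp (\<Sum>g\<in>J. b g * chi g x))
      = (\<Sum>x\<in>?V. \<Prod>g\<in>J. sinh (b g) * chi g x + cosh (b g))"
    using finJ by (simp add: exp_sum exp_mult_chi)
  also have "\<dots> = (\<Sum>x\<in>?V. \<Sum>T\<in>Pow J. (\<Prod>g\<in>T. sinh (b g) * chi g x) * (\<Prod>g\<in>J - T. cosh (b g)))"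
    by (simp add: prod_add finJ)
  also have "\<dots> = (\<Sum>T\<in>Pow J. (\<Prod>g\<in>T. sinh (b g)) * (\<Prod>g\<in>J - T. cosh (b g)) * (\<Sum>x\<in>?V. \<Prod>g\<in>T. chi g x))"
    by (subst sum.swap) (simp add: prod.distrib sum_distrib_left mult_ac)
  also have "\<dots> = (\<Sum>T\<in>Pow J. if T = {} then real (card ?V) * (\<Prod>g\<in>J. cosh (b g)) else 0)"
    by (intro sum.cong refl) (auto simp: zero)
  also have "\<dots> = real (card ?V) * (\<Prod>g\<in>J. cosh (b g))"
    using finJ by (subst sum.delta) auto
  finally show ?thesis .
qed

text \<open>Chang's level-1 inequality. The moment generating function of \<open>\<Sum>g. bias A g * chi g x / 2\<close>
  over the whole space factorises by independence, while its restriction to \<open>A\<close> is bounded below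
  through the tangent of \<open>exp\<close> at the mean.\<close>

lemma level_1_inequality:
  assumes A: "A \<subseteq> carrier_vec n" "A \<noteq> {}"
    and J: "J \<subseteq> carrier_vec n" and ind: "independent_chars n J"
  shows "real (card A) * exp ((\<Sum>g\<in>J. (bias A g)\<^sup>2) / 4) \<le> real (card (carrier_vec n :: bit vec set))"
proof -
  let ?V = "carrier_vec n :: bit vec set"
  define S where "S = (\<Sum>g\<in>J. (bias A g)\<^sup>2)"
  \<comment> \<open>With the weights halved, w has mean S / 2 on A, while over the whole space the
    bound on cosh costs only a factor exp (S / 4).\<close>
  define w where "w x = (\<Sum>g\<in>J. bias A g / 2 * chi g x)" for x
  have finA: "finite A" using A finite_subset finite_carrier_vec_bit by blast
  have sum_chi_A: "(\<Sum>x\<in>A. chi g x) = real (card A) * bias A g" for g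
    using finA A by (simp add: bias_def)
  have "(\<Sum>x\<in>A. w x) = (\<Sum>g\<in>J. bias A g / 2 * (\<Sum>x\<in>A. chi g x))"
    unfolding w_def by (subst sum.swap) (simp add: sum_distrib_left)
  also have "\<dots> = real (card A) * (S / 2)"
    unfolding sum_chi_A S_def by (simp add: sum_distrib_left sum_divide_distrib power2_eq_square mult_ac)
  finally have sum_w: "(\<Sum>x\<in>A. w x) = real (card A) * (S / 2)" .
  have "real (card A) * exp (S / 2) = (\<Sum>x\<in>A. exp (S / 2) * (1 + (w x - S / 2)))"
    using sum_w by (simp add: sum.distrib sum_subtractf flip: sum_distrib_left)
  also have "\<dots> \<le> (\<Sum>x\<in>A. exp (S / 2) * exp (w x - S / 2))"
    by (intro sum_mono mult_left_mono exp_ge_add_one_self) auto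
  also have "\<dots> = (\<Sum>x\<in>A. exp (w x))"
    by (simp flip: exp_add)
  also have "\<dots> \<le> (\<Sum>x\<in>?V. exp (w x))"
    using A by (intro sum_mono2) auto
  also have "\<dots> = real (card ?V) * (\<Prod>g\<in>J. cosh (bias A g / 2))"
    unfolding w_def by (rule sum_exp_independent_chars[OF J ind])
  also have "\<dots> \<le> real (card ?V) * (\<Prod>g\<in>J. exp ((bias A g / 2)\<^sup>2))"
  proof (intro mult_left_mono prod_mono conjI)
    fix g show "cosh (bias A g / 2) \<le> exp ((bias A g / 2)\<^sup>2)"
      using abs_bias_le_1[of A g] by (intro cosh_le_exp_square) auto
  qed auto
  also have "\<dots> = real (card ?V) * exp (S / 4)"
    using J finite_subset[OF J] by (simp add: S_def exp_sum[symmetric] sum_divide_distrib power_divide)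
  finally have "real (card A) * exp (S / 4) * exp (S / 4) \<le> real (card ?V) * exp (S / 4)"
    by (simp add: mult.assoc flip: exp_add)
  then show ?thesis unfolding S_def by simp
qed

section \<open>Fourier analysis on boxes\<close>

text \<open>J spans the set H of characters with large average squared bias, so a character
  separating two points that agree on J lies outside H. The size of J is bounded by double counting
  squared biases over J and I.\<close>

lemma exists_few_controlling_chars:
  fixes A :: "'i \<Rightarrow> bit vec set"
  assumes I: "finite I" "I \<noteq> {}" and A: "\<And>i. i \<in> I \<Longrightarrow> A i \<subseteq> carrier_vec n"
    and large: "real (card (carrier_vec n :: bit vec set)) ^ card I
      \<le> (\<Prod>i\<in>I. real (card (A i))) * 4 ^ (c * card I)"
  shows "\<exists>J\<subseteq>carrier_vec n. card J \<le> 128 * c \<and>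
    (\<forall>y\<in>carrier_vec n. \<forall>z\<in>carrier_vec n. (\<forall>g\<in>J. chi g y = chi g z) \<longrightarrow>
       (\<forall>g\<in>carrier_vec n. chi g y \<noteq> chi g z \<longrightarrow> (\<Prod>i\<in>I. \<bar>bias (A i) g\<bar>) \<le> (1 / 4) ^ card I))"
proof -
  let ?V = "carrier_vec n :: bit vec set"
  define q where "q = real (card ?V)"
  define K where "K = card I"
  define H where "H = {g \<in> ?V. real K / 16 \<le> (\<Sum>i\<in>I. (bias (A i) g)\<^sup>2)}"
  have "0 < K" using I by (auto simp: K_def card_gt_0_iff)
  have "0 < q" using card_carrier_vec_bit_pos by (simp add: q_def)
  have HV: "H \<subseteq> ?V" by (auto simp: H_def)
  obtain J where J: "J \<subseteq> H" "independent_chars n J"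
    and span: "\<And>y z g. y \<in> ?V \<Longrightarrow> z \<in> ?V \<Longrightarrow> \<forall>g\<in>J. chi g y = chi g z \<Longrightarrow> g \<in> H \<Longrightarrow> chi g y = chi g z"
    using exists_spanning_independent_chars[OF HV] by blast
  have JV: "J \<subseteq> ?V" using J HV by auto
  define S where "S i = (\<Sum>g\<in>J. (bias (A i) g)\<^sup>2)" for i
  define p where "p = (\<Prod>i\<in>I. real (card (A i)))"
  \<comment> \<open>The density assumption already forces the box, and so each of its sides, to be
    nonempty.\<close>
  have "0 < p * 4 ^ (c * K)"
    using large \<open>0 < q\<close> unfolding p_def K_def q_def by (metis less_le_trans zero_less_power)
  then have "0 < p" by (simp add: zero_less_mult_iff)
  then have ne: "A i \<noteq> {}" if "i \<in> I" for i
    using that I unfolding p_def by (metis card.empty less_irrefl of_nat_0 prod_zero)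
  have "p * exp (\<Sum>i\<in>I. S i / 4) = (\<Prod>i\<in>I. real (card (A i)) * exp (S i / 4))"
    using I by (simp add: p_def exp_sum prod.distrib)
  also have "\<dots> \<le> (\<Prod>i\<in>I. q)"
    using level_1_inequality[OF A ne JV J(2)]
    by (intro prod_mono) (auto simp: S_def q_def)
  also have "\<dots> \<le> p * 4 ^ (c * K)"
    using large by (simp add: q_def p_def K_def)
  finally have "exp (\<Sum>i\<in>I. S i / 4) \<le> 4 ^ (c * K)"
    using \<open>0 < p\<close> by simp
  \<comment> \<open>Rounding 4 up to exp 2 bounds the sum of all \<open>S i\<close> by 8 * c * K.
    Each member of J contributes at least K / 16 to it, hence 128 * c.\<close>
  also have "\<dots> \<le> exp 2 ^ (c * K)"
  proof (intro power_mono)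
    have "(2::real) \<le> exp 1" using exp_ge_add_one_self[of 1] by simp
    then have "(2::real) * 2 \<le> exp 1 * exp 1" by (intro mult_mono) auto
    then show "(4::real) \<le> exp 2" by (simp flip: exp_add)
  qed simp
  also have "\<dots> = exp (2 * real (c * K))"
    by (metis exp_of_nat2_mult mult.commute)
  finally have "(\<Sum>i\<in>I. S i / 4) \<le> 2 * real (c * K)" by simp
  then have "(\<Sum>i\<in>I. S i) \<le> 8 * real (c * K)"
    by (simp flip: sum_divide_distrib)
  moreover have "(\<Sum>i\<in>I. S i) = (\<Sum>g\<in>J. \<Sum>i\<in>I. (bias (A i) g)\<^sup>2)"
    unfolding S_def by (rule sum.swap)
  moreover have "(\<Sum>g\<in>J. real K / 16) \<le> (\<Sum>g\<in>J. \<Sum>i\<in>I. (bias (A i) g)\<^sup>2)"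
    using J by (intro sum_mono) (auto simp: H_def)
  ultimately have "real (card J) * real K \<le> 128 * real c * real K"
    by simp
  then have "real (card J) \<le> real (128 * c)"
    using \<open>0 < K\<close> by simp
  then have "card J \<le> 128 * c" by (simp only: of_nat_le_iff)
  moreover have "(\<Prod>i\<in>I. \<bar>bias (A i) g\<bar>) \<le> (1 / 4) ^ K"
    if "g \<in> ?V" "g \<notin> H" for g
  proof -
    have small: "(\<Sum>i\<in>I. (bias (A i) g)\<^sup>2) \<le> real K / 16"
      using that by (auto simp: H_def)
    have "(\<Prod>i\<in>I. \<bar>bias (A i) g\<bar>)\<^sup>2 = (\<Prod>i\<in>I. (bias (A i) g)\<^sup>2)"
      by (simp add: prod_power_distrib)
    \<comment> \<open>The arithmetic-geometric mean inequality in exponential form: t \<le> exp (16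
      * t - 1) / 16, with equality at t = 1 / 16, the threshold in H.\<close>
    also have "\<dots> \<le> (\<Prod>i\<in>I. 1 / 16 * exp (16 * (bias (A i) g)\<^sup>2 - 1))"
    proof (intro prod_mono conjI)
      fix i
      show "(bias (A i) g)\<^sup>2 \<le> 1 / 16 * exp (16 * (bias (A i) g)\<^sup>2 - 1)"
        using exp_ge_add_one_self[of "16 * (bias (A i) g)\<^sup>2 - 1"] by simp
    qed auto
    also have "\<dots> = (1 / 16) ^ K * exp (\<Sum>i\<in>I. 16 * (bias (A i) g)\<^sup>2 - 1)"
      using I by (simp only: prod.distrib exp_sum prod_constant K_def)
    also have "\<dots> \<le> (1 / 16) ^ K * 1"
      using small by (intro mult_left_mono) (auto simp: sum_subtractf K_def simp flip: sum_distrib_left)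
    also have "\<dots> = ((1 / 4) ^ K)\<^sup>2"
      by (simp add: power2_eq_square flip: power_mult_distrib)
    finally show ?thesis by (rule power2_le_imp_le) simp
  qed
  ultimately show ?thesis
    using JV span unfolding K_def by (intro exI[of _ J]) blast
qed

lemma sum_prod_chi_PiE:
  assumes "finite I" "\<And>i. i \<in> I \<Longrightarrow> A i \<subseteq> carrier_vec n" "\<And>i. i \<in> I \<Longrightarrow> A i \<noteq> {}"
  shows "(\<Sum>\<omega>\<in>PiE I A. \<Prod>i\<in>I. chi g (\<omega> i)) = real (card (PiE I A)) * (\<Prod>i\<in>I. bias (A i) g)"
proof -
  have fin: "finite (A i)" if "i \<in> I" for i
    using assms that finite_subset finite_carrier_vec_bit by blast
  have "(\<Sum>\<omega>\<in>PiE I A. \<Prod>i\<in>I. chi g (\<omega> i)) = (\<Prod>i\<in>I. \<Sum>x\<in>A i. chi g x)"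
    by (rule prod_sum_PiE[symmetric]) (use assms fin in auto)
  also have "\<dots> = (\<Prod>i\<in>I. real (card (A i)) * bias (A i) g)"
    using assms fin by (intro prod.cong refl) (auto simp: bias_def)
  finally show ?thesis
    using assms by (simp add: prod.distrib card_PiE)
qed

text \<open>Orthogonality of characters. The Fourier coefficients of f stay written out as sums over
  w, so that later only values of f have to be bounded.\<close>

lemma fourier_inversion:
  fixes u :: "bit vec" and f :: "bit vec \<Rightarrow> real"
  assumes "u \<in> carrier_vec n"
  shows "real (card (carrier_vec n :: bit vec set)) * f u
    = (\<Sum>w\<in>carrier_vec n. f w * (\<Sum>g\<in>carrier_vec n. chi g w * chi g u))"
proof -
  let ?V = "carrier_vec n :: bit vec set"
  have "(\<Sum>g\<in>?V. chi g w * chi g u) = (if w = u then real (card ?V) else 0)" if w: "w \<in> ?V" for w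
  proof -
    have "(\<Sum>g\<in>?V. chi g w * chi g u) = (\<Sum>g\<in>?V. chi (w + u) g)"
      using w assms by (intro sum.cong refl) (simp add: chi_add[symmetric] chi_commute[of _ n])
    then show ?thesis
      using w assms by (simp add: sum_chi bit_vec_eq_add_iff)
  qed
  then have "(\<Sum>w\<in>?V. f w * (\<Sum>g\<in>?V. chi g w * chi g u))
      = (\<Sum>w\<in>?V. if w = u then real (card ?V) * f u else 0)"
    by (intro sum.cong) auto
  then show ?thesis using assms by (simp add: sum.delta)
qed

text \<open>The average is the convolution of f with the law of a sum of independent uniform points
  of the \<open>A i\<close>, which multiplies each Fourier coefficient by the product of the
  biases.\<close>

lemma average_over_box_fourier:
  fixes A :: "'i \<Rightarrow> bit vec set"
  assumes I: "finite I" and A: "\<And>i. i \<in> I \<Longrightarrow> A i \<subseteq> carrier_vec n" "\<And>i. i \<in> I \<Longrightarrow> A i \<noteq> {}"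
    and x: "x \<in> carrier_vec n"
  shows "real (card (carrier_vec n :: bit vec set)) *
      ((\<Sum>\<omega>\<in>PiE I A. f (x + finsum_vec TYPE(bit) n \<omega> I)) / real (card (PiE I A)))
    = (\<Sum>w\<in>carrier_vec n. f w * (\<Sum>g\<in>carrier_vec n. chi g w * (chi g x * (\<Prod>i\<in>I. bias (A i) g))))"
proof -
  let ?V = "carrier_vec n :: bit vec set" and ?B = "PiE I A"
  have finA: "finite (A i)" if "i \<in> I" for i
    using A that finite_subset finite_carrier_vec_bit by blast
  have "finite ?B" "?B \<noteq> {}"
    using I finA A by (auto intro: finite_PiE simp: PiE_eq_empty_iff)
  then have B: "real (card ?B) \<noteq> 0" by simp
  have closed: "finsum_vec TYPE(bit) n \<omega> I \<in> ?V" if "\<omega> \<in> ?B" for \<omega>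
    using that A by (intro finsum_vec_closed) (auto dest: PiE_mem)
  have chi_sum: "chi g (x + finsum_vec TYPE(bit) n \<omega> I) = chi g x * (\<Prod>i\<in>I. chi g (\<omega> i))"
    if "\<omega> \<in> ?B" "g \<in> ?V" for \<omega> g
  proof -
    have "\<omega> \<in> I \<rightarrow> ?V" using that A by (auto dest: PiE_mem)
    then show ?thesis
      using that x closed I by (simp add: chi_add chi_finsum)
  qed
  have box: "(\<Sum>\<omega>\<in>?B. \<Prod>i\<in>I. chi g (\<omega> i)) = real (card ?B) * (\<Prod>i\<in>I. bias (A i) g)" for g
    using I A by (intro sum_prod_chi_PiE) auto
  have "real (card ?V) * (\<Sum>\<omega>\<in>?B. f (x + finsum_vec TYPE(bit) n \<omega> I))
      = (\<Sum>\<omega>\<in>?B. \<Sum>w\<in>?V. f w * (\<Sum>g\<in>?V. chi g w * (chi g x * (\<Prod>i\<in>I. chi g (\<omega> i)))))"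
    unfolding sum_distrib_left
  proof (intro sum.cong refl)
    fix \<omega> assume "\<omega> \<in> ?B"
    then show "real (card ?V) * f (x + finsum_vec TYPE(bit) n \<omega> I)
        = (\<Sum>w\<in>?V. \<Sum>g\<in>?V. f w * (chi g w * (chi g x * (\<Prod>i\<in>I. chi g (\<omega> i)))))"
      using closed x chi_sum by (simp add: fourier_inversion[of _ n] sum_distrib_left)
  qed
  also have "\<dots> = (\<Sum>w\<in>?V. f w * (\<Sum>g\<in>?V. chi g w * (chi g x * (\<Sum>\<omega>\<in>?B. \<Prod>i\<in>I. chi g (\<omega> i)))))"
    unfolding sum_distrib_left
    by (subst sum.swap, intro sum.cong refl, rule sum.swap)
  also have "\<dots> = real (card ?B) *
      (\<Sum>w\<in>?V. f w * (\<Sum>g\<in>?V. chi g w * (chi g x * (\<Prod>i\<in>I. bias (A i) g))))"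
    unfolding box unfolding sum_distrib_left
    by (intro sum.cong refl) (simp only: mult_ac)
  finally show ?thesis
    by (simp only: times_divide_eq_right nonzero_mult_div_cancel_left[OF B])
qed

text \<open>Characters that agree at y and z cancel from the difference. The double sum has q^2
  terms of size at most 2 * \<delta>; dividing by the q on the left leaves one factor q, at most 2 ^
  n.\<close>

lemma average_over_box_near_junta:
  fixes A :: "'i \<Rightarrow> bit vec set" and f :: "bit vec \<Rightarrow> real"
  assumes I: "finite I" and A: "\<And>i. i \<in> I \<Longrightarrow> A i \<subseteq> carrier_vec n" "\<And>i. i \<in> I \<Longrightarrow> A i \<noteq> {}"
    and f: "f \<in> carrier_vec n \<rightarrow> {0..1}"
    and yz: "y \<in> carrier_vec n" "z \<in> carrier_vec n"
    and small: "\<And>g. g \<in> carrier_vec n \<Longrightarrow> chi g y \<noteq> chi g z \<Longrightarrow> (\<Prod>i\<in>I. \<bar>bias (A i) g\<bar>) \<le> \<delta>"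
    and "0 \<le> \<delta>"
  defines "G \<equiv> \<lambda>x. (\<Sum>\<omega>\<in>PiE I A. f (x + finsum_vec TYPE(bit) n \<omega> I)) / real (card (PiE I A))"
  shows "\<bar>G y - G z\<bar> \<le> 2 * 2 ^ n * \<delta>"
proof -
  let ?V = "carrier_vec n :: bit vec set"
  define q where "q = real (card ?V)"
  have "0 < q"
    using card_carrier_vec_bit_pos by (simp add: q_def)
  have "q \<le> real (2 ^ n)"
    unfolding q_def using card_carrier_vec_bit_le by (rule of_nat_mono)
  then have "q \<le> 2 ^ n" by simp
  define b where "b g = (\<Prod>i\<in>I. bias (A i) g)" for g
  have G: "q * G x = (\<Sum>w\<in>?V. f w * (\<Sum>g\<in>?V. chi g w * (chi g x * b g)))" if "x \<in> ?V" for x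
    unfolding q_def G_def b_def by (rule average_over_box_fourier[OF I A that])
  have term_le: "\<bar>chi g w * ((chi g y - chi g z) * b g)\<bar> \<le> 2 * \<delta>" if "g \<in> ?V" for g w
  proof (cases "chi g y = chi g z")
    case False
    have "\<bar>b g\<bar> \<le> \<delta>" using small[OF that False] by (simp add: b_def abs_prod)
    moreover have "\<bar>chi g y - chi g z\<bar> \<le> 2" by (simp add: chi_def)
    ultimately have "\<bar>chi g y - chi g z\<bar> * \<bar>b g\<bar> \<le> 2 * \<delta>"
      using \<open>0 \<le> \<delta>\<close> by (intro mult_mono) auto
    then show ?thesis by (simp add: abs_mult)
  qed (use \<open>0 \<le> \<delta>\<close> in simp)
  have "q * (G y - G z) = (\<Sum>w\<in>?V. f w * (\<Sum>g\<in>?V. chi g w * ((chi g y - chi g z) * b g)))"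
    using G[OF yz(1)] G[OF yz(2)]
    by (simp add: right_diff_distrib left_diff_distrib sum_subtractf)
  then have "\<bar>q * (G y - G z)\<bar> \<le> (\<Sum>w\<in>?V. \<bar>f w * (\<Sum>g\<in>?V. chi g w * ((chi g y - chi g z) * b g))\<bar>)"
    by simp
  also have "\<dots> \<le> (\<Sum>w\<in>?V. 1 * (\<Sum>g\<in>?V. 2 * \<delta>))"
    unfolding abs_mult
  proof (intro sum_mono mult_mono)
    fix w assume "w \<in> ?V"
    then show "\<bar>f w\<bar> \<le> 1" using f by (auto simp: Pi_iff)
    have "\<bar>\<Sum>g\<in>?V. chi g w * ((chi g y - chi g z) * b g)\<bar>
        \<le> (\<Sum>g\<in>?V. \<bar>chi g w * ((chi g y - chi g z) * b g)\<bar>)" by (rule sum_abs)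
    also have "\<dots> \<le> (\<Sum>g\<in>?V. 2 * \<delta>)" by (intro sum_mono term_le)
    finally show "\<bar>\<Sum>g\<in>?V. chi g w * ((chi g y - chi g z) * b g)\<bar> \<le> (\<Sum>g\<in>?V. 2 * \<delta>)" .
  qed auto
  also have "\<dots> = q * (q * (2 * \<delta>))" by (simp add: q_def)
  finally have "\<bar>G y - G z\<bar> \<le> q * (2 * \<delta>)"
    using \<open>0 < q\<close> by (simp add: abs_mult)
  also have "\<dots> \<le> 2 ^ n * (2 * \<delta>)"
    using \<open>q \<le> 2 ^ n\<close> \<open>0 \<le> \<delta>\<close> by (intro mult_right_mono) auto
  finally show ?thesis by (simp add: mult_ac)
qed

section \<open>Linear juntas close to box averages\<close>

lemma linear_functional_scalar_prod:
  "g \<in> carrier_vec n \<Longrightarrow> linear_functional n (\<lambda>x. g \<bullet> x)"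
  by (auto simp: linear_functional_def scalar_prod_add_distrib[of _ n])

text \<open>The junta evaluates \<open>G\<close> at a fixed representative of the class of x under
  J. Within a class only characters with a small product of biases vary, so \<open>G\<close> hardly
  changes.\<close>

lemma exists_junta_near_box_average:
  fixes A :: "'i \<Rightarrow> bit vec set" and f :: "bit vec \<Rightarrow> real"
  assumes I: "finite I" "I \<noteq> {}" and A: "\<And>i. i \<in> I \<Longrightarrow> A i \<subseteq> carrier_vec n" "\<And>i. i \<in> I \<Longrightarrow> A i \<noteq> {}"
    and large: "real (card (carrier_vec n :: bit vec set)) ^ card I
      \<le> (\<Prod>i\<in>I. real (card (A i))) * 4 ^ (c * card I)"
    and f: "f \<in> carrier_vec n \<rightarrow> {0..1}"
  defines "G \<equiv> \<lambda>x. (\<Sum>\<omega>\<in>PiE I A. f (x + finsum_vec TYPE(bit) n \<omega> I)) / real (card (PiE I A))"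
  shows "\<exists>g. linear_junta n (128 * c) g \<and>
    (\<forall>x\<in>carrier_vec n. g x \<in> {0..1} \<and> \<bar>g x - G x\<bar> \<le> 2 * 2 ^ n * (1 / 4) ^ card I)"
proof -
  let ?V = "carrier_vec n :: bit vec set"
  define k where "k = 128 * c"
  obtain J where J: "J \<subseteq> ?V" "card J \<le> k"
    and ctrl: "\<And>y z g. y \<in> ?V \<Longrightarrow> z \<in> ?V \<Longrightarrow> \<forall>g\<in>J. chi g y = chi g z \<Longrightarrow> g \<in> ?V \<Longrightarrow>
      chi g y \<noteq> chi g z \<Longrightarrow> (\<Prod>i\<in>I. \<bar>bias (A i) g\<bar>) \<le> (1 / 4) ^ card I"
    using exists_few_controlling_chars[OF I A(1) large] unfolding k_def by blast
  have "finite J" using J finite_subset finite_carrier_vec_bit by blast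
  then obtain e where e: "bij_betw e {0..<card J} J"
    using ex_bij_betw_nat_finite by blast
  \<comment> \<open>J may have fewer than k elements; the remaining functionals are zero.\<close>
  define L where "L i = (if i < card J then (\<lambda>x. e i \<bullet> x) else (\<lambda>_. 0))" for i
  define cell where "cell x = vec k (\<lambda>i. L i x)" for x
  \<comment> \<open>Values that \<open>cell\<close> does not attain are sent to 0, which keeps h in
    the unit interval.\<close>
  define h where "h v = (if \<exists>y\<in>?V. cell y = v then G (SOME y. y \<in> ?V \<and> cell y = v) else 0)" for v
  have L: "linear_functional n (L i)" for i
  proof (cases "i < card J")
    case True
    then have "e i \<in> J" using e by (auto simp: bij_betw_def)
    then show ?thesis
      using True J linear_functional_scalar_prod[of "e i" n] by (auto simp: L_def)
  qed (simp add: L_def linear_functional_def)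
  have G01: "G x \<in> {0..1}" if "x \<in> ?V" for x
  proof -
    have "f (x + finsum_vec TYPE(bit) n \<omega> I) \<in> {0..1}" if "\<omega> \<in> PiE I A" for \<omega>
    proof -
      have "finsum_vec TYPE(bit) n \<omega> I \<in> ?V"
        using that A by (intro finsum_vec_closed) (auto dest: PiE_mem)
      then show ?thesis using f \<open>x \<in> ?V\<close> by (auto simp: Pi_iff)
    qed
    then have bounds: "0 \<le> f (x + finsum_vec TYPE(bit) n \<omega> I)" "f (x + finsum_vec TYPE(bit) n \<omega> I) \<le> 1"
      if "\<omega> \<in> PiE I A" for \<omega>
      using that by auto
    have "0 \<le> (\<Sum>\<omega>\<in>PiE I A. f (x + finsum_vec TYPE(bit) n \<omega> I))"
      by (intro sum_nonneg bounds)
    moreover have "(\<Sum>\<omega>\<in>PiE I A. f (x + finsum_vec TYPE(bit) n \<omega> I)) \<le> real (card (PiE I A)) * 1"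
      by (intro sum_bounded_above bounds)
    ultimately show ?thesis unfolding G_def by (auto simp: divide_le_eq_1)
  qed
  have some: "(SOME y. y \<in> ?V \<and> cell y = v) \<in> ?V \<and> cell (SOME y. y \<in> ?V \<and> cell y = v) = v"
    if "\<exists>y\<in>?V. cell y = v" for v
    using someI_ex[of "\<lambda>y. y \<in> ?V \<and> cell y = v"] that by auto
  have h01: "h v \<in> {0..1}" for v
    using G01 some[of v] by (auto simp: h_def)
  have close: "\<bar>h (cell x) - G x\<bar> \<le> 2 * 2 ^ n * (1 / 4) ^ card I" if x: "x \<in> ?V" for x
  proof -
    define y where "y = (SOME y. y \<in> ?V \<and> cell y = cell x)"
    have y: "y \<in> ?V" "cell y = cell x"
      using some[of "cell x"] x unfolding y_def by blast+
    have hy: "h (cell x) = G y" using x unfolding h_def y_def by auto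
    have "\<forall>g\<in>J. chi g y = chi g x"
    proof
      fix g assume "g \<in> J"
      then obtain i where i: "i < card J" "g = e i"
        using e unfolding bij_betw_def by (metis atLeastLessThan_iff imageE)
      then have "cell y $ i = cell x $ i" "i < k" using y J by auto
      then show "chi g y = chi g x"
        using i by (simp add: cell_def L_def chi_def)
    qed
    then show ?thesis
      unfolding hy G_def using ctrl[OF y(1) x]
      by (intro average_over_box_near_junta[OF I(1) A f y(1) x]) auto
  qed
  have "linear_junta n k (\<lambda>x. h (cell x))"
    unfolding linear_junta_def using L h01
    by (intro exI[of _ L] exI[of _ h]) (auto simp: cell_def)
  then show ?thesis
    using h01 close unfolding k_def by blast
qed

section \<open>Mean squared error over fibres\<close>

text \<open>By Cauchy-Schwarz the mean of u has squared error at most the average squared error of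
  u; a is within \<delta> of that mean.\<close>

lemma sum_square_fibre_le:
  fixes u :: "'a \<Rightarrow> real"
  assumes "finite F" "\<bar>a - (\<Sum>\<omega>\<in>F. u \<omega>) / real (card F)\<bar> \<le> \<delta>"
  shows "real (card F) * (a - t)\<^sup>2 \<le> 2 * (\<Sum>\<omega>\<in>F. (u \<omega> - t)\<^sup>2) + 2 * \<delta>\<^sup>2 * real (card F)"
proof (cases "F = {}")
  case False
  define k where "k = real (card F)"
  have "0 < k" using assms False by (simp add: k_def card_gt_0_iff)
  define b where "b = (\<Sum>\<omega>\<in>F. u \<omega>) / k"
  have "(k * (b - t))\<^sup>2 = (\<Sum>\<omega>\<in>F. u \<omega> - t)\<^sup>2"
    using \<open>0 < k\<close> by (simp add: b_def sum_subtractf right_diff_distrib k_def)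
  also have "\<dots> \<le> (\<Sum>\<omega>\<in>F. (u \<omega> - t)\<^sup>2) * k"
    unfolding k_def by (rule sum_squared_le_sum_of_squares)
  finally have "k * (k * (b - t)\<^sup>2) \<le> k * (\<Sum>\<omega>\<in>F. (u \<omega> - t)\<^sup>2)"
    by (simp add: power2_eq_square mult_ac)
  then have mean: "k * (b - t)\<^sup>2 \<le> (\<Sum>\<omega>\<in>F. (u \<omega> - t)\<^sup>2)"
    using \<open>0 < k\<close> by simp
  have "(a - b)\<^sup>2 \<le> \<delta>\<^sup>2"
    using assms(2) unfolding b_def k_def by (metis abs_ge_zero power2_abs power_mono)
  \<comment> \<open>This splitting is the source of the factor 2 in front of \<epsilon>.\<close>
  moreover have "(a - t)\<^sup>2 \<le> 2 * (a - b)\<^sup>2 + 2 * (b - t)\<^sup>2"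
    using zero_le_power2[of "(a - b) - (b - t)"] by (simp add: power2_eq_square algebra_simps)
  ultimately have "(a - t)\<^sup>2 \<le> 2 * \<delta>\<^sup>2 + 2 * (b - t)\<^sup>2" by linarith
  then have "k * (a - t)\<^sup>2 \<le> k * (2 * \<delta>\<^sup>2 + 2 * (b - t)\<^sup>2)"
    using \<open>0 < k\<close> by (intro mult_left_mono) auto
  also have "\<dots> = 2 * \<delta>\<^sup>2 * k + 2 * (k * (b - t)\<^sup>2)" by (simp add: algebra_simps)
  finally show ?thesis using mean unfolding k_def by linarith
qed simp

text \<open>There are few transcripts, so the rare ones have small total mass whatever they are; only on
  the others does the prediction have to be close to the conditional mean.\<close>

lemma sum_square_fibres_le:
  fixes u :: "'a \<Rightarrow> real" and v :: "'m \<Rightarrow> real" and L :: real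
  assumes fin: "finite \<Omega>" "finite M" and img: "\<tau> ` \<Omega> \<subseteq> M"
    and M: "real (card M) \<le> L" "0 < L"
    and t: "t \<in> {0..1}" and v: "\<And>m. m \<in> M \<Longrightarrow> v m \<in> {0..1}"
    and close: "\<And>m. m \<in> M \<Longrightarrow> real (card \<Omega>) \<le> L\<^sup>2 * real (card {\<omega>\<in>\<Omega>. \<tau> \<omega> = m}) \<Longrightarrow>
      \<bar>v m - (\<Sum>\<omega> | \<omega> \<in> \<Omega> \<and> \<tau> \<omega> = m. u \<omega>) / real (card {\<omega>\<in>\<Omega>. \<tau> \<omega> = m})\<bar> \<le> \<delta>"
  shows "(\<Sum>\<omega>\<in>\<Omega>. (v (\<tau> \<omega>) - t)\<^sup>2) \<le> 2 * (\<Sum>\<omega>\<in>\<Omega>. (u \<omega> - t)\<^sup>2) + real (card \<Omega>) * (2 * \<delta>\<^sup>2 + 1 / L)"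
proof -
  define F where "F m = {\<omega>\<in>\<Omega>. \<tau> \<omega> = m}" for m
  have finF: "finite (F m)" for m using fin by (simp add: F_def)
  have group: "(\<Sum>m\<in>M. \<Sum>\<omega>\<in>F m. w \<omega>) = (\<Sum>\<omega>\<in>\<Omega>. w \<omega>)" for w :: "'a \<Rightarrow> real"
    unfolding F_def using fin img by (rule sum.group)
  \<comment> \<open>The right side carries the errors of both cases, frequent and rare, so that one
    bound can be summed over M.\<close>
  have "(\<Sum>\<omega>\<in>F m. (v (\<tau> \<omega>) - t)\<^sup>2)
      \<le> 2 * (\<Sum>\<omega>\<in>F m. (u \<omega> - t)\<^sup>2) + 2 * \<delta>\<^sup>2 * (\<Sum>\<omega>\<in>F m. 1) + real (card \<Omega>) / L\<^sup>2"
    if m: "m \<in> M" for m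
  proof -
    have lhs: "(\<Sum>\<omega>\<in>F m. (v (\<tau> \<omega>) - t)\<^sup>2) = real (card (F m)) * (v m - t)\<^sup>2"
      by (simp add: F_def)
    show ?thesis
    proof (cases "real (card \<Omega>) \<le> L\<^sup>2 * real (card (F m))")
      case True
      then have "\<bar>v m - (\<Sum>\<omega>\<in>F m. u \<omega>) / real (card (F m))\<bar> \<le> \<delta>"
        using close[OF m] unfolding F_def by blast
      from sum_square_fibre_le[OF finF this, of t] show ?thesis
        unfolding lhs by (simp add: add_increasing2)
    next
      \<comment> \<open>A rare fibre has fewer than card \<Omega> / L^2 points, each of error at
        most 1; at most L such fibres cost card \<Omega> / L in total.\<close>
      case False
      have "\<bar>v m - t\<bar> \<le> 1" using v[OF m] t by auto
      then have "(v m - t)\<^sup>2 \<le> 1" by (simp add: abs_square_le_1)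
      then have "real (card (F m)) * (v m - t)\<^sup>2 \<le> real (card (F m)) * 1"
        by (intro mult_left_mono) auto
      also have "\<dots> \<le> real (card \<Omega>) / L\<^sup>2"
        using False M by (simp add: field_simps)
      finally show ?thesis
        unfolding lhs using sum_nonneg[of "F m" "\<lambda>\<omega>. (u \<omega> - t)\<^sup>2"] by (simp add: add_increasing)
    qed
  qed
  then have "(\<Sum>m\<in>M. \<Sum>\<omega>\<in>F m. (v (\<tau> \<omega>) - t)\<^sup>2)
      \<le> (\<Sum>m\<in>M. 2 * (\<Sum>\<omega>\<in>F m. (u \<omega> - t)\<^sup>2) + 2 * \<delta>\<^sup>2 * (\<Sum>\<omega>\<in>F m. 1) + real (card \<Omega>) / L\<^sup>2)"
    by (intro sum_mono)
  then have "(\<Sum>\<omega>\<in>\<Omega>. (v (\<tau> \<omega>) - t)\<^sup>2)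
      \<le> 2 * (\<Sum>\<omega>\<in>\<Omega>. (u \<omega> - t)\<^sup>2) + 2 * \<delta>\<^sup>2 * (\<Sum>\<omega>\<in>\<Omega>. 1) + real (card M) * (real (card \<Omega>) / L\<^sup>2)"
    unfolding sum.distrib sum_distrib_left[symmetric] group by simp
  also have "real (card M) * (real (card \<Omega>) / L\<^sup>2) \<le> L * (real (card \<Omega>) / L\<^sup>2)"
    using M by (intro mult_right_mono) auto
  also have "\<dots> = real (card \<Omega>) * (1 / L)"
    using M by (simp add: power2_eq_square)
  finally show ?thesis by (simp add: algebra_simps)
qed

section \<open>Transcripts of a protocol\<close>

lemma finite_bitstrings [simp]: "finite (bitstrings c)"
  using finite_lists_length_eq[of "UNIV :: bool set" c] by (simp add: bitstrings_def)

lemma card_bitstrings: "card (bitstrings c) = 2 ^ c"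
  using card_lists_length_eq[of "UNIV :: bool set" c] by (simp add: bitstrings_def card_UNIV_bool)

lemma length_transcript [simp]: "length (transcript P x r k) = k"
  by (induction k) auto

lemma transcript_cong:
  "(\<And>i. i \<in> {1..k} \<Longrightarrow> x i = y i) \<Longrightarrow> transcript P x r k = transcript P y r k"
  by (induction k) auto

lemma set_transcript_subset:
  assumes "one_way_broadcasting n N c P" "r \<in> bitstrings (rand_len P)"
    and "k < N" "\<And>i. i \<in> {1..k} \<Longrightarrow> x i \<in> carrier_vec n"
  shows "set (transcript P x r k) \<subseteq> bitstrings c"
  using assms(3,4)
proof (induction k)
  case (Suc k)
  then have "set (transcript P x r k) \<subseteq> bitstrings c" by auto
  moreover have "msg P (Suc k) (x (Suc k)) (transcript P x r k) r \<in> bitstrings c"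
    using assms(1,2) Suc.prems calculation unfolding one_way_broadcasting_def by auto
  ultimately show ?case by simp
qed simp

text \<open>The messages that player i has seen are read off from m instead of being computed from
  other inputs. Each condition then concerns a single input, which makes the set of inputs with a
  given transcript a box.\<close>

lemma transcript_eq_iff:
  "length m = k \<Longrightarrow> transcript P x r k = m \<longleftrightarrow>
    (\<forall>i\<in>{1..k}. msg P i (x i) (take (i - 1) m) r = m ! (i - 1))"
proof (induction k arbitrary: m)
  case (Suc k)
  define m' where "m' = take k m"
  have m: "m = m' @ [m ! k]" "length m' = k"
    using Suc.prems take_Suc_conv_app_nth[of k m] by (simp_all add: m'_def)
  have "transcript P x r (Suc k) = m \<longleftrightarrow>
      transcript P x r k = m' \<and> msg P (Suc k) (x (Suc k)) m' r = m ! k"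
    by (subst m(1)) auto
  also have "transcript P x r k = m' \<longleftrightarrow>
      (\<forall>i\<in>{1..k}. msg P i (x i) (take (i - 1) m') r = m' ! (i - 1))"
    using Suc.IH m(2) by blast
  also have "\<dots> \<longleftrightarrow> (\<forall>i\<in>{1..k}. msg P i (x i) (take (i - 1) m) r = m ! (i - 1))"
    by (intro ball_cong refl) (auto simp: m'_def min_def)
  finally show ?case
    by (auto simp: m'_def atLeastAtMostSuc_conv)
qed simp

text \<open>Players are numbered from 1, positions in the transcript from 0.\<close>

definition consistent_inputs ::
  "nat \<Rightarrow> broadcast_protocol \<Rightarrow> bitstring \<Rightarrow> bitstring list \<Rightarrow> nat \<Rightarrow> bit vec set" where
  "consistent_inputs n P r m i = {x \<in> carrier_vec n. msg P i x (take (i - 1) m) r = m ! (i - 1)}"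

lemma transcript_fibre_eq_box:
  assumes "length m = N - 1"
  shows "{\<omega> \<in> {1..<N} \<rightarrow>\<^sub>E carrier_vec n. transcript P \<omega> r (N - 1) = m}
    = PiE {1..<N} (consistent_inputs n P r m)"
proof -
  have eq: "{1..N - 1} = {1..<N}" by auto
  show ?thesis
    unfolding transcript_eq_iff[OF assms] eq
    by (rule Set.set_eqI) (auto simp add: consistent_inputs_def PiE_iff)
qed

lemma finsum_vec_cong:
  "g \<in> A \<rightarrow> carrier_vec n \<Longrightarrow> (\<And>i. i \<in> A \<Longrightarrow> f i = g i) \<Longrightarrow>
    finsum_vec TYPE('a :: comm_monoid_add) n f A = finsum_vec TYPE('a) n g A"
  unfolding finsum_vec_def
  by (rule comm_monoid.finprod_cong'[OF comm_monoid_vec]) (auto simp: monoid_vec_simps)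

text \<open>In characteristic 2 the two copies of s cancel, so player N can fix the total at x
  whatever the others hold.\<close>

lemma finsum_vec_complete_to:
  fixes x :: "bit vec" and N :: nat
  assumes "0 < N" "x \<in> carrier_vec n" "\<omega> \<in> {1..<N} \<rightarrow> carrier_vec n"
  defines "s \<equiv> finsum_vec TYPE(bit) n \<omega> {1..<N}"
  shows "finsum_vec TYPE(bit) n (fun_upd \<omega> N (x + s)) {1..N} = x"
proof -
  have s: "s \<in> carrier_vec n"
    using assms finsum_vec_closed[of \<omega> "{1..<N}" n] unfolding s_def by auto
  have "{1..N} = insert N {1..<N}" using assms by auto
  moreover have "finsum_vec TYPE(bit) n (fun_upd \<omega> N (x + s)) (insert N {1..<N})
      = (x + s) + finsum_vec TYPE(bit) n (fun_upd \<omega> N (x + s)) {1..<N}"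
    using assms s by (subst finsum_vec_insert) auto
  moreover have "finsum_vec TYPE(bit) n (fun_upd \<omega> N (x + s)) {1..<N} = s"
    unfolding s_def using assms by (intro finsum_vec_cong) auto
  moreover have "(x + s) + s = x"
    using bit_vec_add_cancel[OF \<open>x \<in> carrier_vec n\<close> s] s \<open>x \<in> carrier_vec n\<close>
    by (simp add: comm_add_vec[of _ n s])
  ultimately show ?thesis by simp
qed

section \<open>The sketch obtained from a protocol\<close>

text \<open>The sketch draws r and the first N - 1 inputs uniformly and returns the junta attached
  to their transcript. This sampling does not depend on x, which enters the simulated run only
  through the last player.\<close>

lemma exists_sketch_of_protocol:
  fixes f :: "bit vec \<Rightarrow> real"
  assumes N: "1 < N" and P: "one_way_broadcasting n N c P"
    and approx: "protocol_approximates n N \<epsilon> P (\<lambda>x. f (finsum_vec TYPE(bit) n x {1..N}))"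
    and f: "f \<in> carrier_vec n \<rightarrow> {0..1}"
  shows "\<exists>S. linear_sketch n (128 * c) S \<and>
    sketch_approximates n (2 * \<epsilon> + (2 * (2 * 2 ^ n * (1 / 4) ^ (N - 1))\<^sup>2 + 1 / 2 ^ (c * (N - 1)))) S f"
proof -
  let ?V = "carrier_vec n :: bit vec set"
  define K where "K = N - 1"
  define I where "I = {1..<N}"
  define \<Omega> where "\<Omega> = I \<rightarrow>\<^sub>E ?V"
  define R where "R = bitstrings (rand_len P)"
  define M where "M = {m. set m \<subseteq> bitstrings c \<and> length m = K}"
  define \<tau> where "\<tau> r \<omega> = transcript P \<omega> r K" for r \<omega>
  define u where "u r x \<omega> = out P (x + finsum_vec TYPE(bit) n \<omega> I) (\<tau> r \<omega>) r" for r x \<omega>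
  \<comment> \<open>The number of possible transcripts; its square 4 ^ (c * K) sets the threshold
    between frequent and rare.\<close>
  define L :: real where "L = 2 ^ (c * K)"
  define \<delta> :: real where "\<delta> = 2 * 2 ^ n * (1 / 4) ^ K"
  define \<eta> where "\<eta> = 2 * \<delta>\<^sup>2 + 1 / L"
  define F where "F r m = {\<omega> \<in> \<Omega>. \<tau> r \<omega> = m}" for r m
  have I: "finite I" "I \<noteq> {}" "card I = K" using N by (auto simp: I_def K_def)
  have \<Omega>: "finite \<Omega>" unfolding \<Omega>_def using I by (intro finite_PiE) auto
  have "\<Omega> \<noteq> {}"
    unfolding \<Omega>_def PiE_eq_empty_iff using zero_carrier_vec by blast
  have "replicate (rand_len P) False \<in> R" by (simp add: R_def bitstrings_def)
  then have R: "finite R" "R \<noteq> {}" by (auto simp: R_def)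
  have M: "finite M" "card M = (2 ^ c) ^ K"
    unfolding M_def by (simp_all add: finite_lists_length_eq card_lists_length_eq card_bitstrings)
  have \<tau>M: "\<tau> r ` \<Omega> \<subseteq> M" if "r \<in> R" for r
  proof
    fix m assume "m \<in> \<tau> r ` \<Omega>"
    then obtain \<omega> where \<omega>: "\<omega> \<in> \<Omega>" "m = \<tau> r \<omega>" by auto
    have "set (\<tau> r \<omega>) \<subseteq> bitstrings c"
      unfolding \<tau>_def using P that \<omega> N
      by (intro set_transcript_subset) (auto simp: R_def K_def \<Omega>_def I_def PiE_iff)
    then show "m \<in> M" using \<omega> by (simp add: M_def \<tau>_def)
  qed
  have "\<exists>g. linear_junta n (128 * c) g \<and> (\<forall>x\<in>?V. g x \<in> {0..1} \<and>
      (real (card \<Omega>) \<le> L\<^sup>2 * real (card (F r m)) \<longrightarrow>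
        \<bar>g x - (\<Sum>\<omega>\<in>F r m. u r x \<omega>) / real (card (F r m))\<bar> \<le> \<delta>))"
    if r: "r \<in> R" and m: "m \<in> M" for r m
  proof (cases "real (card \<Omega>) \<le> L\<^sup>2 * real (card (F r m))")
    case True
    define A where "A = consistent_inputs n P r m"
    have AV: "A i \<subseteq> ?V" for i by (auto simp: A_def consistent_inputs_def)
    have FA: "F r m = PiE I A"
      using m unfolding F_def \<Omega>_def \<tau>_def I_def A_def M_def K_def
      by (intro transcript_fibre_eq_box) simp
    have "0 < card \<Omega>" using \<Omega> \<open>\<Omega> \<noteq> {}\<close> by (simp add: card_gt_0_iff)
    then have "F r m \<noteq> {}" using True by auto
    then have ne: "A i \<noteq> {}" if "i \<in> I" for i
      using that by (auto simp: FA PiE_eq_empty_iff)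
    have card: "real (card \<Omega>) = real (card ?V) ^ card I"
      "real (card (F r m)) = (\<Prod>i\<in>I. real (card (A i)))"
      using I by (simp_all add: FA \<Omega>_def card_PiE)
    have L2: "L\<^sup>2 = 4 ^ (c * card I)"
      unfolding L_def I(3) by (simp add: power2_eq_square flip: power_mult_distrib)
    have large: "real (card ?V) ^ card I \<le> (\<Prod>i\<in>I. real (card (A i))) * 4 ^ (c * card I)"
      using True unfolding card L2 by (simp only: mult.commute)
    \<comment> \<open>The function averaged over the box is not f but the output as a function of
      the last player's input, for fixed m and r.\<close>
    have "(\<lambda>y. out P y m r) \<in> ?V \<rightarrow> {0..1}"
      using P r m unfolding one_way_broadcasting_def R_def M_def K_def by auto
    from exists_junta_near_box_average[OF I(1,2) AV ne large this]
    obtain g where g: "linear_junta n (128 * c) g"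
      and close: "\<And>x. x \<in> ?V \<Longrightarrow> g x \<in> {0..1} \<and>
        \<bar>g x - (\<Sum>\<omega>\<in>F r m. out P (x + finsum_vec TYPE(bit) n \<omega> I) m r) / real (card (F r m))\<bar> \<le> \<delta>"
      unfolding \<delta>_def I(3) FA by blast
    have "(\<Sum>\<omega>\<in>F r m. out P (x + finsum_vec TYPE(bit) n \<omega> I) m r) = (\<Sum>\<omega>\<in>F r m. u r x \<omega>)" for x
      by (intro sum.cong refl) (simp add: u_def F_def)
    then show ?thesis using g close by (intro exI[of _ g]) auto
  next
    \<comment> \<open>A rare transcript gets the constant junta 0; only its range matters
      there.\<close>
    case False
    have "linear_junta n (128 * c) (\<lambda>_. 0)"
      unfolding linear_junta_def
      by (intro exI[of _ "\<lambda>_ _. 0"] exI[of _ "\<lambda>_. 0"]) (auto simp: linear_functional_def)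
    then show ?thesis using False by (intro exI[of _ "\<lambda>_. 0"]) auto
  qed
  then obtain g where junta: "\<And>r m. r \<in> R \<Longrightarrow> m \<in> M \<Longrightarrow> linear_junta n (128 * c) (g r m)"
    and g01: "\<And>r m x. r \<in> R \<Longrightarrow> m \<in> M \<Longrightarrow> x \<in> ?V \<Longrightarrow> g r m x \<in> {0..1}"
    and close: "\<And>r m x. r \<in> R \<Longrightarrow> m \<in> M \<Longrightarrow> x \<in> ?V \<Longrightarrow> real (card \<Omega>) \<le> L\<^sup>2 * real (card (F r m)) \<Longrightarrow>
        \<bar>g r m x - (\<Sum>\<omega>\<in>F r m. u r x \<omega>) / real (card (F r m))\<bar> \<le> \<delta>"
    by metis
  \<comment> \<open>The guarantee holds for every input tuple, so \<omega> is fixed, completed to a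
    tuple with sum x, and only r is averaged.\<close>
  have error: "(\<Sum>r\<in>R. (u r x \<omega> - f x)\<^sup>2) \<le> real (card R) * \<epsilon>" if x: "x \<in> ?V" and \<omega>: "\<omega> \<in> \<Omega>" for x \<omega>
  proof -
    define X where "X = fun_upd \<omega> N (x + finsum_vec TYPE(bit) n \<omega> I)"
    have \<omega>V: "\<omega> \<in> {1..<N} \<rightarrow> ?V" using \<omega> by (auto simp: \<Omega>_def I_def PiE_iff)
    have sV: "finsum_vec TYPE(bit) n \<omega> I \<in> ?V"
      using \<omega>V unfolding I_def by (rule finsum_vec_closed)
    have "X \<in> {1..N} \<rightarrow> ?V"
      using \<omega>V sV x by (auto simp: X_def Pi_iff)
    moreover have "finsum_vec TYPE(bit) n X {1..N} = x"
      unfolding X_def I_def using N x \<omega>V by (intro finsum_vec_complete_to) auto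
    moreover have "transcript P X r K = \<tau> r \<omega>" for r
      unfolding \<tau>_def using N by (intro transcript_cong) (auto simp: X_def K_def)
    then have "protocol_output N P X r = u r x \<omega>" for r
      unfolding protocol_output_def u_def by (simp add: X_def K_def)
    ultimately have "measure_pmf.expectation (pmf_of_set R) (\<lambda>r. \<bar>u r x \<omega> - f x\<bar>\<^sup>2) \<le> \<epsilon>"
      using approx unfolding protocol_approximates_def R_def by fastforce
    then show ?thesis
      using R by (simp add: integral_pmf_of_set pos_divide_le_eq card_gt_0_iff mult.commute)
  qed
  define S where "S = map_pmf (\<lambda>(r, \<omega>). g r (\<tau> r \<omega>)) (pmf_of_set (R \<times> \<Omega>))"
  have R\<Omega>: "finite (R \<times> \<Omega>)" "R \<times> \<Omega> \<noteq> {}"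
    using R \<Omega> \<open>\<Omega> \<noteq> {}\<close> by auto
  have "linear_junta n (128 * c) (g r (\<tau> r \<omega>))" if "r \<in> R" "\<omega> \<in> \<Omega>" for r \<omega>
    using \<tau>M[OF that(1)] that(2) by (intro junta that(1)) auto
  then have "linear_sketch n (128 * c) S"
    by (auto simp: linear_sketch_def S_def set_pmf_of_set[OF R\<Omega>(2,1)])
  moreover have "measure_pmf.expectation S (\<lambda>g. \<bar>g x - f x\<bar>\<^sup>2) \<le> 2 * \<epsilon> + \<eta>"
    if x: "x \<in> ?V" for x
  proof -
    have fx: "f x \<in> {0..1}" using f x by auto
    have "(\<Sum>\<omega>\<in>\<Omega>. (g r (\<tau> r \<omega>) x - f x)\<^sup>2)
        \<le> 2 * (\<Sum>\<omega>\<in>\<Omega>. (u r x \<omega> - f x)\<^sup>2) + real (card \<Omega>) * \<eta>" if r: "r \<in> R" for r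
      unfolding \<eta>_def
    proof (rule sum_square_fibres_le[where M = M])
      show "real (card M) \<le> L" "0 < L" using M by (simp_all add: L_def power_mult)
      show "g r m x \<in> {0..1}" if "m \<in> M" for m using g01[OF r that x] .
      show "\<bar>g r m x - (\<Sum>\<omega> | \<omega> \<in> \<Omega> \<and> \<tau> r \<omega> = m. u r x \<omega>) / real (card {\<omega> \<in> \<Omega>. \<tau> r \<omega> = m})\<bar> \<le> \<delta>"
        if "m \<in> M" "real (card \<Omega>) \<le> L\<^sup>2 * real (card {\<omega> \<in> \<Omega>. \<tau> r \<omega> = m})" for m
        using close[OF r that(1) x] that(2) unfolding F_def by blast
    qed (use \<Omega> M \<tau>M[OF r] fx in auto)
    then have "(\<Sum>r\<in>R. \<Sum>\<omega>\<in>\<Omega>. (g r (\<tau> r \<omega>) x - f x)\<^sup>2)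
        \<le> (\<Sum>r\<in>R. 2 * (\<Sum>\<omega>\<in>\<Omega>. (u r x \<omega> - f x)\<^sup>2) + real (card \<Omega>) * \<eta>)"
      by (intro sum_mono)
    \<comment> \<open>The sums are exchanged so that the inner one runs over r, where the guarantee
      for fixed \<omega> applies.\<close>
    also have "\<dots> = 2 * (\<Sum>\<omega>\<in>\<Omega>. \<Sum>r\<in>R. (u r x \<omega> - f x)\<^sup>2)
        + real (card R) * (real (card \<Omega>) * \<eta>)"
      unfolding sum.distrib sum_distrib_left[symmetric]
      by (subst sum.swap) simp
    also have "\<dots> \<le> 2 * (\<Sum>\<omega>\<in>\<Omega>. real (card R) * \<epsilon>)
        + real (card R) * (real (card \<Omega>) * \<eta>)"
      using error[OF x] by (intro add_right_mono mult_left_mono sum_mono) auto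
    also have "\<dots> = real (card (R \<times> \<Omega>)) * (2 * \<epsilon> + \<eta>)"
      by (simp add: card_cartesian_product algebra_simps)
    finally have "(\<Sum>(r, \<omega>)\<in>R \<times> \<Omega>. (g r (\<tau> r \<omega>) x - f x)\<^sup>2)
        \<le> real (card (R \<times> \<Omega>)) * (2 * \<epsilon> + \<eta>)"
      by (simp only: sum.cartesian_product)
    moreover have "0 < real (card (R \<times> \<Omega>))"
      using R\<Omega> by (metis card_gt_0_iff of_nat_0_less_iff)
    ultimately have "(\<Sum>(r, \<omega>)\<in>R \<times> \<Omega>. (g r (\<tau> r \<omega>) x - f x)\<^sup>2) / real (card (R \<times> \<Omega>))
        \<le> 2 * \<epsilon> + \<eta>"
      by (simp only: pos_divide_le_eq mult.commute)
    then show ?thesis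
      unfolding S_def integral_map_pmf integral_pmf_of_set[OF R\<Omega>(2,1)]
      by (simp add: case_prod_unfold)
  qed
  ultimately show ?thesis
    unfolding sketch_approximates_def \<eta>_def \<delta>_def L_def K_def by blast
qed

text \<open>Each of the two terms is at most half of the bound, hence the -1 in their
  exponents.\<close>

lemma sketch_error_le:
  fixes n N c :: nat
  assumes "0 < n" "0 < c" "10 * n \<le> N"
  shows "2 * (2 * 2 ^ n * (1 / 4) ^ (N - 1))\<^sup>2 + 1 / 2 ^ (c * (N - 1)) \<le> 2 powr (- (1 / 2) * real N)"
proof -
  define K where "K = N - 1"
  have K: "real K = real N - 1" using assms by (simp add: K_def of_nat_diff)
  have "2 * (2 * 2 ^ n * (1 / 4) ^ K)\<^sup>2 = (2::real) powr (2 * real n + 3 - 4 * real K)"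
  proof -
    have "(2::real) powr (2 * real n + 3 - 4 * real K) = 2 powr (real (2 * n + 3)) / 2 powr (real (4 * K))"
      by (simp add: powr_diff)
    also have "\<dots> = 2 ^ (2 * n + 3) / 2 ^ (4 * K)"
      by (simp only: powr_realpow zero_less_numeral)
    also have "\<dots> = 8 * 4 ^ n / 16 ^ K"
      by (simp add: power_add power_mult)
    also have "\<dots> = 2 * (2 * 2 ^ n * (1 / 4) ^ K)\<^sup>2"
      by (simp add: power2_eq_square power_divide flip: power_mult_distrib)
    finally show ?thesis by simp
  qed
  \<comment> \<open>The comparison of exponents amounts to 2 * n + 8 \<le> 7 / 2 * N.\<close>
  also have "\<dots> \<le> 2 powr (- (1 / 2) * real N - 1)"
    using assms K by (intro powr_mono) auto
  finally have 1: "2 * (2 * 2 ^ n * (1 / 4) ^ K)\<^sup>2 \<le> (2::real) powr (- (1 / 2) * real N - 1)" .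
  have "1 / 2 ^ (c * K) \<le> (1::real) / 2 ^ K"
    using assms by (intro divide_left_mono power_increasing) auto
  also have "\<dots> = 2 powr (- real K)"
    by (simp add: powr_minus powr_realpow field_simps)
  also have "\<dots> \<le> 2 powr (- (1 / 2) * real N - 1)"
    using assms K by (intro powr_mono) auto
  finally have 2: "1 / 2 ^ (c * K) \<le> (2::real) powr (- (1 / 2) * real N - 1)" .
  have "(2::real) powr (- (1 / 2) * real N - 1) + 2 powr (- (1 / 2) * real N - 1) = 2 powr (- (1 / 2) * real N)"
    by (simp add: powr_diff)
  with 1 2 show ?thesis unfolding K_def by linarith
qed

text \<open>The constants are C = 128, from the number of spanning characters, and \<alpha> = 1 / 2,
  from the error estimate.\<close>

theorem theorem3p1:
  shows "\<exists>C>0::real. \<exists>\<alpha>>0::real.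
    \<forall>(n::nat) (N::nat) (c::nat) (f :: bit vec \<Rightarrow> real) (\<epsilon>::real).
      0 < n \<longrightarrow> 0 < N \<longrightarrow> 0 < c \<longrightarrow> N \<ge> 10 * n \<longrightarrow>
      f \<in> carrier_vec n \<rightarrow> {0..1} \<longrightarrow>
      (\<exists>P. one_way_broadcasting n N c P \<and>
           protocol_approximates n N \<epsilon> P (\<lambda>x. f (finsum_vec TYPE(bit) n x {1..N}))) \<longrightarrow>
      (\<exists>k S. real k \<le> C * real c \<and> linear_sketch n k S \<and>
           sketch_approximates n (2 * \<epsilon> + 2 powr (- \<alpha> * real N)) S f)"
proof (rule exI[of _ 128], intro exI[of _ "1 / 2"] conjI allI impI)
  fix n N c :: nat and f :: "bit vec \<Rightarrow> real" and \<epsilon> :: real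
  assume pos: "0 < n" "0 < c" "10 * n \<le> N" and f: "f \<in> carrier_vec n \<rightarrow> {0..1}"
    and "\<exists>P. one_way_broadcasting n N c P \<and>
           protocol_approximates n N \<epsilon> P (\<lambda>x. f (finsum_vec TYPE(bit) n x {1..N}))"
  moreover have "1 < N" using pos by linarith
  ultimately obtain S where S: "linear_sketch n (128 * c) S"
    "sketch_approximates n (2 * \<epsilon> + (2 * (2 * 2 ^ n * (1 / 4) ^ (N - 1))\<^sup>2 + 1 / 2 ^ (c * (N - 1)))) S f"
    using exists_sketch_of_protocol by blast
  have "sketch_approximates n (2 * \<epsilon> + 2 powr (- (1 / 2) * real N)) S f"
    using S(2) sketch_error_le[OF pos] unfolding sketch_approximates_def
    by (meson add_left_mono order_trans)
  then show "\<exists>k S. real k \<le> 128 * real c \<and> linear_sketch n k S \<and>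
      sketch_approximates n (2 * \<epsilon> + 2 powr (- (1 / 2) * real N)) S f"
    using S(1) by (intro exI[of _ "128 * c"] exI[of _ S]) auto
qed auto

end
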